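(* For every positive integer $r$ there is an integer $m$ such that $$b_{13}\left(13^{2r}m+\frac{13^{2r}-1}{2}\right)\not\equiv0\pmod{13}.$$ Moreover there is an integer $m$ such that $$b_{17}(17m-12)\not\equiv0\pmod{17}.$$
   Context: $b_\ell(n)$ is the number of $\ell$-regular partitions of $n$, defined by $\sum_{n\ge0}b_\ell(n)q^n=\prod_{n\ge1}\frac{1-q^{\ell n}}{1-q^n}$, with $b_\ell(n)=0$ for $n<0$. *)

theory Defs
  imports
    "HOL-Analysis.Infinite_Products"
    "HOL-Library.Multiset"
    "HOL-Computational_Algebra.Formal_Power_Series"
    "HOL-Number_Theory.Cong"
begin

definition partitions_with :: "nat set \<Rightarrow> nat \<Rightarrow> nat multiset set" where
  "partitions_with S n = {p. set_mset p \<subseteq> S \<and> sum_mset p = n}"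

definition regular_parts :: "nat \<Rightarrow> nat set" where
  "regular_parts l = {k. 0 < k \<and> \<not> l dvd k}"

(* The argument is an integer because the convention b l n = 0 for n < 0 is part of the definition.
   Agreement with the generating function is theorem b_generating_function below. *)
definition b :: "nat \<Rightarrow> int \<Rightarrow> nat" where
  "b l n = (if n < 0 then 0 else card (partitions_with (regular_parts l) (nat n)))"

lemma member_le_sum_mset:
  fixes p :: "nat multiset"
  assumes "k \<in># p"
  shows "k \<le> sum_mset p"
  using assms by (metis le_add1 multi_member_split sum_mset.add_mset)

lemma size_le_sum_mset:
  fixes p :: "nat multiset"
  assumes "0 \<notin># p"
  shows "size p \<le> sum_mset p"
  using assms
proof (induction p)
  case (add x p)
  then have "x > 0" "size p \<le> sum_mset p" by auto
  then show ?case by simp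
qed simp

lemma finite_partitions_with:
  assumes "0 \<notin> S"
  shows "finite (partitions_with S n)"
proof -
  have "partitions_with S n \<subseteq> mset ` {xs. set xs \<subseteq> {..n} \<and> length xs \<le> n}"
  proof
    fix p assume p: "p \<in> partitions_with S n"
    obtain xs where xs: "p = mset xs" by (metis ex_mset)
    have "set xs \<subseteq> {..n}"
      using p xs member_le_sum_mset by (fastforce simp: partitions_with_def)
    moreover have "length xs \<le> n"
      using p xs assms size_le_sum_mset[of p] by (auto simp: partitions_with_def)
    ultimately show "p \<in> mset ` {xs. set xs \<subseteq> {..n} \<and> length xs \<le> n}" using xs by blast
  qed
  moreover have "finite {xs. set xs \<subseteq> {..n} \<and> length xs \<le> n}"
    by (rule finite_lists_length_le) simp
  ultimately show ?thesis by (meson finite_imageI finite_subset)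
qed

lemma card_partitions_with_insert:
  assumes "0 \<notin> S" "k > 0" "k \<notin> S"
  shows "card (partitions_with (insert k S) n) =
           card (partitions_with S n) +
           (if k \<le> n then card (partitions_with (insert k S) (n - k)) else 0)"
proof -
  have fin: "finite (partitions_with S n)" "finite (partitions_with (insert k S) m)" for m
    using assms by (auto intro!: finite_partitions_with)
  define A where "A = {p \<in> partitions_with (insert k S) n. k \<in># p}"
  have split: "partitions_with (insert k S) n = partitions_with S n \<union> A"
    using assms by (auto simp: partitions_with_def A_def)
  have disj: "partitions_with S n \<inter> A = {}"
    using assms by (auto simp: partitions_with_def A_def)
  have finA: "finite A" using fin by (simp add: A_def)
  have A: "card A = (if k \<le> n then card (partitions_with (insert k S) (n - k)) else 0)"
  proof (cases "k \<le> n")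
    case True
    have "A = add_mset k ` partitions_with (insert k S) (n - k)"
    proof (intro equalityI subsetI)
      fix p assume p: "p \<in> A"
      then obtain q where q: "p = add_mset k q" by (auto simp: A_def dest: multi_member_split)
      with p have "q \<in> partitions_with (insert k S) (n - k)"
        by (auto simp: A_def partitions_with_def)
      with q show "p \<in> add_mset k ` partitions_with (insert k S) (n - k)" by blast
    qed (use True in \<open>auto simp: A_def partitions_with_def\<close>)
    moreover have "inj_on (add_mset k) (partitions_with (insert k S) (n - k))"
      by (auto intro: inj_onI)
    ultimately show ?thesis using True by (simp add: card_image)
  next
    case False
    have "A = {}"
      using False member_le_sum_mset by (auto simp: A_def partitions_with_def)
    then show ?thesis using False by simp
  qed
  have "card (partitions_with (insert k S) n) = card (partitions_with S n) + card A"
    using card_Un_disjoint[OF fin(1) finA disj] by (simp only: split)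
  then show ?thesis by (simp only: A)
qed

lemma fps_partitions_with_finite:
  assumes "finite S" "0 \<notin> S"
  shows "(\<Prod>k\<in>S. 1 - fps_X ^ k) * Abs_fps (\<lambda>n. of_nat (card (partitions_with S n))) =
           (1 :: rat fps)"
  using assms
proof (induction S rule: finite_induct)
  case empty
  have "card (partitions_with {} n) = (if n = 0 then 1 else 0)" for n
  proof -
    have "partitions_with {} n = (if n = 0 then {{#}} else {})"
      by (auto simp: partitions_with_def)
    then show ?thesis by simp
  qed
  then show ?case by (intro fps_ext) simp
next
  case (insert k S)
  define F where "F = (\<lambda>S. Abs_fps (\<lambda>n. of_nat (card (partitions_with S n))) :: rat fps)"
  have step: "(1 - fps_X ^ k) * F (insert k S) = F S"
  proof (rule fps_ext)
    fix n
    show "fps_nth ((1 - fps_X ^ k) * F (insert k S)) n = fps_nth (F S) n"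
      using card_partitions_with_insert[of S k n] insert
      by (auto simp: algebra_simps fps_X_power_mult_nth F_def)
  qed
  have "(\<Prod>j\<in>insert k S. 1 - fps_X ^ j) * F (insert k S) =
          (\<Prod>j\<in>S. 1 - fps_X ^ j) * ((1 - fps_X ^ k) * F (insert k S))"
    using insert by (simp add: algebra_simps)
  also have "\<dots> = 1" unfolding step using insert by (simp add: F_def)
  finally show ?case by (simp add: F_def)
qed

lemma fps_prod_one_minus_nth:
  assumes "finite T" "\<And>k. k \<in> T \<Longrightarrow> N < k" "i \<le> N"
  shows "fps_nth ((F :: rat fps) * (\<Prod>k\<in>T. 1 - fps_X ^ k)) i = fps_nth F i"
  using assms
proof (induction T arbitrary: F rule: finite_induct)
  case (insert k T)
  have "fps_nth (F * (\<Prod>j\<in>insert k T. 1 - fps_X ^ j)) i =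
          fps_nth ((F * (1 - fps_X ^ k)) * (\<Prod>j\<in>T. 1 - fps_X ^ j)) i"
    using insert by (simp add: mult.assoc)
  also have "\<dots> = fps_nth (F * (1 - fps_X ^ k)) i" using insert by blast
  also have "\<dots> = fps_nth F i"
    using insert.prems(1)[of k] \<open>i \<le> N\<close>
    by (simp add: right_diff_distrib fps_X_power_mult_right_nth)
  finally show ?case .
qed simp

theorem b_generating_function:
  assumes "l > 0"
  shows "(\<lambda>n. (1 - fps_X ^ (l * (n + 1))) / (1 - fps_X ^ (n + 1))) has_prod
           (Abs_fps (\<lambda>n. of_nat (b l (int n))) :: rat fps)"
proof -
  define f where "f = (\<lambda>n. (1 - fps_X ^ (l * (n + 1))) / (1 - fps_X ^ (n + 1)) :: rat fps)"
  define g where "g = (\<lambda>k. 1 - fps_X ^ k :: rat fps)"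
  define B where "B = (Abs_fps (\<lambda>n. of_nat (b l (int n))) :: rat fps)"
  have gnz: "fps_nth (g k) 0 = 1" if "k > 0" for k using that by (simp add: g_def)
  have gnz': "g k \<noteq> 0" if "k > 0" for k using gnz[OF that] by auto
  have key: "fps_nth (\<Prod>n\<le>M. f n) i = fps_nth B i" if "i \<le> M" for M i
  proof -
    define N where "N = Suc M"
    define S where "S = {k \<in> {1..N}. \<not> l dvd k}"
    define D where "D = {k \<in> {1..N}. l dvd k}"
    define T where "T = {k \<in> {N<..l*N}. l dvd k}"
    define A where "A = (Abs_fps (\<lambda>n. of_nat (card (partitions_with S n))) :: rat fps)"
    have fin: "finite S" "finite D" "finite T" by (simp_all add: S_def D_def T_def)
    have AS: "prod g S * A = 1"
      using fps_partitions_with_finite[of S] fin by (simp add: A_def g_def S_def)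
    have eq1: "prod g {1..N} = prod g S * prod g D"
    proof -
      have "{1..N} = S \<union> D" "S \<inter> D = {}" by (auto simp: S_def D_def)
      then show ?thesis using fin by (metis prod.union_disjoint)
    qed
    have eq2: "(\<Prod>n\<in>{1..N}. g (l * n)) = prod g D * prod g T"
    proof -
      have im: "(*) l ` {1..N} = D \<union> T"
      proof (intro equalityI subsetI)
        fix x assume "x \<in> (*) l ` {1..N}"
        then show "x \<in> D \<union> T"
          using \<open>l > 0\<close> by (auto simp: D_def T_def Suc_le_eq)
      next
        fix x assume x: "x \<in> D \<union> T"
        then obtain y where y: "x = l * y" by (auto simp: D_def T_def dvd_def)
        have "x > 0" using x by (auto simp: D_def T_def)
        moreover have "x \<le> l * N"
        proof -
          have "N \<le> l * N" using \<open>l > 0\<close> by simp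
          moreover have "x \<le> N \<or> x \<le> l * N" using x by (auto simp: D_def T_def)
          ultimately show ?thesis by linarith
        qed
        ultimately show "x \<in> (*) l ` {1..N}" using y \<open>l > 0\<close> by (auto simp: Suc_le_eq)
      qed
      have "inj_on ((*) l) {1..N}" using \<open>l > 0\<close> by (auto intro: inj_onI)
      then have "(\<Prod>n\<in>{1..N}. g (l * n)) = prod g ((*) l ` {1..N})"
        by (simp add: prod.reindex)
      also have "\<dots> = prod g D * prod g T"
        unfolding im using fin by (intro prod.union_disjoint) (auto simp: D_def T_def)
      finally show ?thesis .
    qed
    have f_mult: "f n * g (n + 1) = g (l * (n + 1))" for n
      using gnz[of "n + 1"] unfolding f_def g_def
      by (simp add: fps_divide_unit mult.assoc inverse_mult_eq_1 del: power_Suc)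
    have shift: "(\<Prod>n\<le>M. h (n + 1)) = prod h {1..N}" for h :: "nat \<Rightarrow> rat fps"
      unfolding N_def
      by (rule prod.reindex_bij_witness[of _ "\<lambda>i. i - 1" "\<lambda>i. i + 1"]) auto
    have "(\<Prod>n\<le>M. f n) * prod g {1..N} = (\<Prod>n\<le>M. f n * g (n + 1))"
      by (simp only: shift[of g, symmetric] prod.distrib)
    also have "\<dots> = (\<Prod>n\<in>{1..N}. g (l * n))"
      by (simp only: f_mult shift[of "\<lambda>n. g (l * n)"])
    also have "\<dots> = (A * prod g T) * prod g {1..N}"
    proof -
      have "(A * prod g T) * prod g {1..N} = (prod g S * A) * (prod g D * prod g T)"
        unfolding eq1 by (simp only: mult_ac)
      then show ?thesis by (simp only: AS eq2 mult_1)
    qed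
    finally have eq: "(\<Prod>n\<le>M. f n) * prod g {1..N} = (A * prod g T) * prod g {1..N}" .
    have "prod g {1..N} \<noteq> 0" using gnz' by (simp add: prod_zero_iff Suc_le_eq)
    with eq have "(\<Prod>n\<le>M. f n) = A * prod g T"
      by (metis mult_right_cancel)
    then have "fps_nth (\<Prod>n\<le>M. f n) i = fps_nth A i"
      using fps_prod_one_minus_nth[of T N i A] fin that
      by (simp add: g_def T_def N_def)
    moreover have parts: "partitions_with S i = partitions_with (regular_parts l) i"
    proof -
      have "k \<in> S \<longleftrightarrow> k \<in> regular_parts l" if "k \<in># p" "sum_mset p = i" for k p
        using member_le_sum_mset[OF that(1)] that(2) \<open>i \<le> M\<close>
        by (auto simp: S_def regular_parts_def N_def)
      then show ?thesis unfolding partitions_with_def by blast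
    qed
    then have "fps_nth A i = fps_nth B i" by (simp add: A_def B_def b_def)
    ultimately show ?thesis by simp
  qed
  have lim: "(\<lambda>M. \<Prod>n\<le>M. f n) \<longlonglongrightarrow> B"
  proof (rule tendsto_fpsI)
    fix i
    show "eventually (\<lambda>M. fps_nth (\<Prod>n\<le>M. f n) i = fps_nth B i) sequentially"
      using eventually_ge_at_top[of i] by eventually_elim (rule key)
  qed
  have "fps_nth B 0 = fps_nth (f 0) 0" using key[of 0 0] by simp
  also have "\<dots> = 1"
    using \<open>l > 0\<close> by (simp add: f_def fps_divide_unit)
  finally have "B \<noteq> 0" by auto
  with lim show ?thesis
    unfolding has_prod_def raw_has_prod_def f_def B_def by simp
qed

end

theory Submission
  imports Defs "HOL-Computational_Algebra.Polynomial"
begin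

text \<open>
  Write \<open>E = \<Prod>k\<ge>1. 1 - q^k\<close>. Modulo 13 the generating function of the 13-regular partitions is
  \<open>E(q^13) / E(q) = E^12\<close>, by the Frobenius map. So \<open>b 13 n\<close> is modulo 13 a coefficient of the
  cusp form \<open>\<eta>(2z)^12\<close>, and it is enough that its coefficients at powers of 13 are not
  divisible by 13. The form is an eigenform of the Hecke operator at 13, and its eigenvalue
  \<open>-418\<close> is prime to 13.
  Modulo 13 this eigenvalue equation has a proof without modular forms.

  By Jacobi's identity, \<open>E^3\<close> is the sum of \<open>x q^((x^2-1)/8)\<close> over all integers \<open>x\<close> congruent to
  1 modulo 4 (\<open>jacobi_cube\<close> and \<open>jacobi_series_eq_theta\<close>); it follows from a finite identity that is the derivative
  of the q-binomial theorem at a zero (\<open>finite_jacobi_cube\<close>). The fourth power of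
  this series makes the coefficient of \<open>q^n\<close> in \<open>E^12\<close> equal to \<open>theta (8n + 4)\<close>, where \<open>theta M\<close> is the
  sum of \<open>x1 x2 x3 x4\<close> over the integer quaternions of norm \<open>M\<close> whose coordinates are all
  congruent to 1 modulo 4 (\<open>theta_series_power_4\<close>).

  Quaternion multiplication now plays the part of the Hecke operator. There are 14 suitably normalised
  quaternions \<open>p\<close> of norm 13. Modulo 13 the quaternions form a \<open>2 \<times> 2\<close> matrix ring and
  the 14 conjugates of the \<open>p\<close> become rank one matrices whose rows run through the 14 points of a projective line.
  Therefore a quaternion \<open>x\<close> whose norm is divisible by 13 is left divisible by exactly one \<open>p\<close>, or by all 14
  if 13 divides \<open>x\<close>; in either case the number of \<open>p\<close> is 1 modulo 13 (\<open>count_primaries13\<close>). On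
  the other hand, summing the product of the coordinates of \<open>p y\<close> over all \<open>p\<close> gives \<open>-418\<close> times the product of
  the coordinates of \<open>y\<close> (\<open>sum_coord_prod_primaries13\<close>). Double counting the factorisations
  \<open>x = p y\<close> yields \<open>theta (13 M) = -418 theta M\<close> modulo 13 (\<open>theta_hecke_13\<close>), and since \<open>theta 4 = 1\<close>, no
  \<open>theta (4 * 13^j)\<close> is divisible by 13.

  For 17 the single value \<open>b 17 5 = 7\<close>, the number of all partitions of 5, is enough.
\<close>

section \<open>A finite form of Jacobi's identity for the cube of Euler's product\<close>

fun qbinom :: "'a :: comm_ring_1 \<Rightarrow> nat \<Rightarrow> nat \<Rightarrow> 'a" where
  "qbinom q n 0 = 1"
| "qbinom q 0 (Suc k) = 0"
| "qbinom q (Suc n) (Suc k) = qbinom q n k + q ^ Suc k * qbinom q n (Suc k)"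

lemmas qbinom_Suc_Suc = qbinom.simps(3)

\<comment> \<open>At \<open>n = 2 * m + 1\<close> this equation would unfold the coefficients whose symmetry is needed below.\<close>
declare qbinom_Suc_Suc [simp del]

definition qfact :: "'a :: comm_ring_1 \<Rightarrow> nat \<Rightarrow> 'a" where
  "qfact q n = (\<Prod>k=1..n. 1 - q ^ k)"

lemma qfact_0 [simp]: "qfact q 0 = 1"
  by (simp add: qfact_def)

lemma qfact_Suc: "qfact q (Suc n) = (1 - q ^ Suc n) * qfact q n"
  by (simp add: qfact_def mult.commute)

lemma qbinom_eq_0: "n < k \<Longrightarrow> qbinom q n k = 0"
  by (induction q n k rule: qbinom.induct) (auto simp: qbinom_Suc_Suc)

lemma qbinom_mult_qfact:
  "qbinom q (k + m) k * (qfact q k * qfact q m) = qfact q (k + m)"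
proof (induction "k + m" arbitrary: k m)
  case (Suc n)
  show ?case
  proof (cases k)
    case k: (Suc k')
    have 1: "qbinom q n k' * (qfact q k' * qfact q m) = qfact q n"
      using Suc.hyps(1)[of k' m] Suc.hyps(2) k by simp
    have 2: "qbinom q n k * (qfact q k * qfact q m) = (1 - q ^ m) * qfact q n"
    proof (cases m)
      case 0
      then show ?thesis using Suc.hyps(2) by (simp add: qbinom_eq_0)
    next
      case m: (Suc m')
      have "qbinom q n k * (qfact q k * qfact q m') = qfact q n"
        using Suc.hyps(1)[of k m'] Suc.hyps(2) m by simp
      moreover have "qbinom q n k * (qfact q k * qfact q m) =
          (1 - q ^ m) * (qbinom q n k * (qfact q k * qfact q m'))"
        by (simp add: m qfact_Suc mult_ac del: power_Suc)
      ultimately show ?thesis by simp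
    qed
    have "qbinom q (k + m) k * (qfact q k * qfact q m) =
            (1 - q ^ k) * (qbinom q n k' * (qfact q k' * qfact q m)) +
            q ^ k * (qbinom q n k * (qfact q k * qfact q m))"
      unfolding Suc.hyps(2)[symmetric] by (simp add: k qbinom_Suc_Suc qfact_Suc algebra_simps)
    also have "\<dots> = ((1 - q ^ k) + q ^ k * (1 - q ^ m)) * qfact q n"
      by (simp only: 1 2) (simp add: algebra_simps)
    also have "(1 - q ^ k) + q ^ k * (1 - q ^ m) = 1 - q ^ Suc n"
      by (simp add: Suc.hyps(2) power_add algebra_simps)
    finally show ?thesis using Suc.hyps(2) by (metis qfact_Suc)
  qed simp
qed simp

text \<open>
  Gauss's q-binomial theorem, by splitting off the factor \<open>j = 0\<close> and replacing \<open>b\<close> by \<open>b q\<close> in the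
  others. It is homogeneous in \<open>a\<close> and \<open>b\<close> because the application below needs
  \<open>a = q^n\<close> with no inverse of \<open>q\<close> at hand.
\<close>
lemma qbinomial_theorem:
  fixes a b q :: "'a :: comm_ring_1"
  shows "(\<Prod>j<n. a + b * q ^ j) = (\<Sum>k\<le>n. q ^ (k choose 2) * qbinom q n k * a ^ (n - k) * b ^ k)"
proof (induction n arbitrary: b)
  case (Suc n)
  let ?c = "\<lambda>k. q ^ (k choose 2)"
  have ch: "Suc k choose 2 = (k choose 2) + k" for k by (simp add: numeral_2_eq_2)
  have "(\<Prod>j<Suc n. a + b * q ^ j) = (a + b) * (\<Prod>j<n. a + (b * q) * q ^ j)"
    by (simp only: prod.lessThan_Suc_shift) (simp add: mult_ac)
  also have "\<dots> = (a + b) * (\<Sum>k\<le>n. ?c k * qbinom q n k * a ^ (n - k) * (b * q) ^ k)"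
    by (simp only: Suc.IH)
  also have "\<dots> = (\<Sum>k\<le>n. ?c k * q ^ k * qbinom q n k * a ^ (Suc n - k) * b ^ k) +
                  (\<Sum>k\<le>n. ?c k * q ^ k * qbinom q n k * a ^ (n - k) * b ^ Suc k)"
    by (simp add: distrib_right sum_distrib_left power_mult_distrib Suc_diff_le sum.distrib mult_ac)
  also have "(\<Sum>k\<le>n. ?c k * q ^ k * qbinom q n k * a ^ (Suc n - k) * b ^ k) =
             (\<Sum>k\<le>Suc n. ?c k * q ^ k * qbinom q n k * a ^ (Suc n - k) * b ^ k)"
    by (simp add: qbinom_eq_0)
  also have "\<dots> = a ^ Suc n + (\<Sum>k\<le>n. ?c (Suc k) * q ^ Suc k * qbinom q n (Suc k) * a ^ (n - k) * b ^ Suc k)"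
    by (subst sum.atMost_Suc_shift) (simp add: binomial_eq_0)
  also have "\<dots> + (\<Sum>k\<le>n. ?c k * q ^ k * qbinom q n k * a ^ (n - k) * b ^ Suc k) =
     a ^ Suc n + (\<Sum>k\<le>n. ?c (Suc k) * qbinom q (Suc n) (Suc k) * a ^ (n - k) * b ^ Suc k)"
    by (simp add: add.assoc sum.distrib[symmetric] ch qbinom_Suc_Suc power_add algebra_simps)
  also have "\<dots> = (\<Sum>k\<le>Suc n. ?c k * qbinom q (Suc n) k * a ^ (Suc n - k) * b ^ k)"
    by (subst sum.atMost_Suc_shift) (simp add: binomial_eq_0)
  finally show ?case .
qed (simp add: binomial_eq_0)

lemma qbinom_pCons: "qbinom [:q:] n k = [:qbinom q n k:]"
  by (induction q n k rule: qbinom.induct) (simp_all add: qbinom_Suc_Suc poly_const_pow one_pCons)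

abbreviation X :: "int fps" where "X \<equiv> fps_X"

lemma qfact_X_nonzero: "qfact X n \<noteq> 0"
proof -
  have "fps_nth (qfact X n) 0 = 1"
    by (induction n) (simp_all add: qfact_Suc)
  then show ?thesis by auto
qed

lemma qbinom_symmetric:
  "qbinom X (k + m) k = qbinom X (k + m) m"
proof -
  have "qbinom X (k + m) k * (qfact X k * qfact X m) =
        qbinom X (k + m) m * (qfact X k * qfact X m)"
    using qbinom_mult_qfact[of X k m] qbinom_mult_qfact[of X m k] by (simp add: mult_ac add.commute)
  then show ?thesis using qfact_X_nonzero by simp
qed

text \<open>
  For \<open>N = 2n + 1\<close> the polynomial \<open>g(y) = \<Prod>j<N. q^n - y q^j\<close> has a middle
  factor \<open>j = n\<close> that vanishes at \<open>y = 1\<close>. Differentiating there therefore leaves the product of the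
  other factors, which is \<open>qfact q n ^ 2\<close> up to a sign and a power of \<open>q\<close>; expanding \<open>g\<close> by the q-binomial theorem first gives
  the sum on the left. The factor \<open>q^n\<close> in place of \<open>1\<close> keeps all exponents nonnegative.
\<close>
lemma qbinomial_derivative:
  fixes q :: "'a :: idom"
  shows "(\<Sum>k\<le>2*n+1. of_nat k * (-1) ^ k * q ^ ((k choose 2) + n * (2*n+1-k)) * qbinom q (2*n+1) k) =
         - ((-1) ^ n * q ^ (n + n * n + (n choose 2)) * qfact q n ^ 2)"
proof -
  define N where "N = 2 * n + 1"
  define f where "f j = [:q ^ n, - (q ^ j):]" for j
  define g where "g = (\<Prod>j<N. f j)"
  have "g = (\<Prod>j<N. [:q ^ n:] + [:0, -1:] * [:q:] ^ j)"
    unfolding g_def f_def by (intro prod.cong) (simp_all add: poly_const_pow)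
  also have "\<dots> = (\<Sum>k\<le>N. [:q:] ^ (k choose 2) * qbinom [:q:] N k * [:q ^ n:] ^ (N - k) * [:0, -1:] ^ k)"
    by (rule qbinomial_theorem)
  also have "\<dots> = (\<Sum>k\<le>N. monom ((-1) ^ k * q ^ ((k choose 2) + n * (N - k)) * qbinom q N k) k)"
  proof (intro sum.cong refl)
    fix k
    have "[:0, -1:] = monom (-1 :: 'a) 1" by (simp add: monom_altdef)
    then have "[:0, -1:] ^ k = monom ((-1 :: 'a) ^ k) k" by (simp add: monom_power)
    then show "[:q:] ^ (k choose 2) * qbinom [:q:] N k * [:q ^ n:] ^ (N - k) * [:0, -1:] ^ k =
        monom ((-1) ^ k * q ^ ((k choose 2) + n * (N - k)) * qbinom q N k) k"
      by (simp add: qbinom_pCons poly_const_pow power_mult power_add smult_monom mult_ac)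
  qed
  finally have "poly (pderiv g) 1 = (\<Sum>k\<le>N. of_nat k * (-1) ^ k * q ^ ((k choose 2) + n * (N - k)) * qbinom q N k)"
    by (simp add: higher_pderiv_sum[of 1, simplified] poly_sum pderiv_monom poly_monom mult_ac)
  moreover have "poly (pderiv g) 1 = - ((-1) ^ n * q ^ (n + n * n + (n choose 2)) * qfact q n ^ 2)"
  proof -
    have ev: "poly (f j) 1 = q ^ n - q ^ j" for j by (simp add: f_def)
    have "poly (pderiv g) 1 = (\<Sum>i<N. poly (prod f ({..<N} - {i})) 1 * poly (pderiv (f i)) 1)"
      by (simp add: g_def pderiv_prod poly_sum)
    also have "\<dots> = (\<Sum>i\<in>{n}. poly (prod f ({..<N} - {i})) 1 * poly (pderiv (f i)) 1)"
    proof (rule sum.mono_neutral_right)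
      show "\<forall>i\<in>{..<N} - {n}. poly (prod f ({..<N} - {i})) 1 * poly (pderiv (f i)) 1 = 0"
      proof
        fix i assume "i \<in> {..<N} - {n}"
        then have "n \<in> {..<N} - {i}" by (auto simp: N_def)
        then have "poly (prod f ({..<N} - {i})) 1 = 0"
          unfolding poly_prod by (intro prod_zero bexI[of _ n]) (auto simp: ev)
        then show "poly (prod f ({..<N} - {i})) 1 * poly (pderiv (f i)) 1 = 0" by simp
      qed
    qed (auto simp: N_def)
    also have "\<dots> = - (q ^ n) * (\<Prod>j\<in>{..<N} - {n}. q ^ n - q ^ j)"
      by (simp add: poly_prod ev) (simp add: f_def pderiv_pCons)
    also have "{..<N} - {n} = {..<n} \<union> {n+1..n+n}" by (auto simp: N_def)
    also have "(\<Prod>j\<in>{..<n} \<union> {n+1..n+n}. q ^ n - q ^ j) =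
       (\<Prod>j<n. q ^ n - q ^ j) * (\<Prod>j=n+1..n+n. q ^ n - q ^ j)"
      by (intro prod.union_disjoint) auto
    also have "(\<Prod>j<n. q ^ n - q ^ j) = (-1) ^ n * q ^ (n choose 2) * qfact q n"
    proof -
      have "(\<Prod>j<n. q ^ n - q ^ j) = (\<Prod>j<n. (-1) * q ^ j * (1 - q ^ (n - j)))"
        by (intro prod.cong) (auto simp: algebra_simps power_add[symmetric])
      also have "\<dots> = (-1) ^ n * (\<Prod>j<n. q ^ j) * (\<Prod>j<n. 1 - q ^ (n - j))"
        by (simp only: prod.distrib prod_constant card_lessThan)
      also have "(\<Prod>j<n. q ^ j) = q ^ (n choose 2)"
        by (induction n) (simp_all add: binomial_eq_0 numeral_2_eq_2 power_add)
      also have "(\<Prod>j<n. 1 - q ^ (n - j)) = qfact q n"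
        unfolding qfact_def
        by (rule prod.reindex_bij_witness[of _ "\<lambda>j. n - j" "\<lambda>j. n - j"]) auto
      finally show ?thesis .
    qed
    also have "(\<Prod>j=n+1..n+n. q ^ n - q ^ j) = q ^ (n * n) * qfact q n"
    proof -
      have "(\<Prod>j=n+1..n+n. q ^ n - q ^ j) = (\<Prod>j=1..n. q ^ n * (1 - q ^ j))"
        by (rule prod.reindex_bij_witness[of _ "\<lambda>j. n + j" "\<lambda>j. j - n"])
          (auto simp: algebra_simps power_add[symmetric])
      then show ?thesis by (simp add: prod.distrib qfact_def power_mult)
    qed
    finally show ?thesis by (simp add: power_add power2_eq_square mult_ac)
  qed
  ultimately show ?thesis unfolding N_def by (simp only:)
qed

lemma two_choose_two: "2 * (m choose 2) + m = m * m"
  by (induction m) (simp_all add: numeral_2_eq_2)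

lemma choose_2_shift_up:
  assumes "i \<le> n"
  shows "(Suc (n + i) choose 2) + n * (n - i) = (n + n*n + (n choose 2)) + (Suc i choose 2)"
proof -
  obtain j where n: "n = i + j" using assms le_Suc_ex by blast
  define A B C where ABC: "A = (Suc (n + i) choose 2)" "B = (n choose 2)" "C = (Suc i choose 2)"
  have "2 * A + Suc (n + i) = Suc (n + i) * Suc (n + i)" "2 * B + n = n * n"
       "2 * C + Suc i = Suc i * Suc i"
    unfolding ABC by (rule two_choose_two)+
  then have "2 * (A + n * (n - i)) = 2 * ((n + n*n + B) + C)"
    unfolding n by (simp add: algebra_simps)
  then show ?thesis by (simp add: ABC)
qed

lemma choose_2_shift_down:
  assumes "i \<le> n"
  shows "(n - i choose 2) + n * Suc (n + i) = (n + n*n + (n choose 2)) + (Suc i choose 2)"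
proof -
  obtain j where n: "n = i + j" using assms le_Suc_ex by blast
  define A B C where ABC: "A = (n - i choose 2)" "B = (n choose 2)" "C = (Suc i choose 2)"
  have "2 * A + (n - i) = (n - i) * (n - i)" "2 * B + n = n * n"
       "2 * C + Suc i = Suc i * Suc i"
    unfolding ABC by (rule two_choose_two)+
  then have "2 * (A + n * Suc (n + i)) = 2 * ((n + n*n + B) + C)"
    unfolding n by (simp add: algebra_simps)
  then show ?thesis by (simp add: ABC)
qed

text \<open>
  In \<open>qbinomial_derivative\<close> the terms \<open>k = n - i\<close> and \<open>k = n + 1 + i\<close> carry
  the same power of \<open>q\<close>, the same q-binomial coefficient and opposite signs, so together they
  contribute the weight \<open>(n + 1 + i) - (n - i) = 2i + 1\<close>. Both sides then share a power of
  \<open>q\<close> that cancels. As \<open>n\<close> grows, the q-binomial coefficients tend to the inverse of Euler's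
  product, which turns the square on the left into Jacobi's cube.
\<close>
theorem finite_jacobi_cube:
  "qfact X n ^ 2 =
    (\<Sum>i\<le>n. (-1) ^ i * of_nat (2*i+1) * X ^ (Suc i choose 2) * qbinom X (2*n+1) (n - i))"
proof -
  define t where "t k = of_nat k * (-1) ^ k * X ^ ((k choose 2) + n * (2*n+1-k)) * qbinom X (2*n+1) k" for k
  define e where "e = n + n*n + (n choose 2)"
  have "(\<Sum>k\<le>2*n+1. t k) = (\<Sum>k\<in>{..n} \<union> {n+1..2*n+1}. t k)"
    by (intro sum.cong) auto
  also have "\<dots> = (\<Sum>k\<le>n. t k) + (\<Sum>k=n+1..2*n+1. t k)"
    by (intro sum.union_disjoint) auto
  also have "(\<Sum>k\<le>n. t k) = (\<Sum>i\<le>n. t (n - i))"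
    by (rule sum.reindex_bij_witness[of _ "\<lambda>i. n - i" "\<lambda>i. n - i"]) auto
  also have "(\<Sum>k=n+1..2*n+1. t k) = (\<Sum>i\<le>n. t (Suc (n + i)))"
    by (rule sum.reindex_bij_witness[of _ "\<lambda>i. Suc (n + i)" "\<lambda>k. k - Suc n"]) auto
  also have "(\<Sum>i\<le>n. t (n - i)) + (\<Sum>i\<le>n. t (Suc (n + i))) = (\<Sum>i\<le>n. t (n - i) + t (Suc (n + i)))"
    by (simp add: sum.distrib)
  also have "\<dots> = (\<Sum>i\<le>n. - ((-1) ^ n * X ^ e) *
      ((-1) ^ i * of_nat (2*i+1) * X ^ (Suc i choose 2) * qbinom X (2*n+1) (n - i)))"
  proof (intro sum.cong refl)
    fix i assume "i \<in> {..n}"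
    then have i: "i \<le> n" by simp
    have sgn: "(-1 :: int fps) ^ (n - i) = (-1) ^ n * (-1) ^ i"
      using i by (metis (no_types, lifting) le_add_diff_inverse2 mult.assoc mult.right_neutral power_add minus_one_mult_self)
    have sub: "2 * n + 1 - (n - i) = Suc (n + i)" "2 * n + 1 - Suc (n + i) = n - i" using i by auto
    have sym: "qbinom X (2*n+1) (Suc (n + i)) = qbinom X (2*n+1) (n - i)"
      using qbinom_symmetric[of "n - i" "Suc (n + i)"] i by (simp add: mult_2)
    define W where "W = (-1) ^ n * (-1) ^ i * X ^ (e + (Suc i choose 2)) * qbinom X (2*n+1) (n - i)"
    have "t (n - i) = of_nat (n - i) * W"
      unfolding t_def W_def sub choose_2_shift_down[OF i] e_def[symmetric] sgn by (simp only: mult_ac)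
    moreover have "t (Suc (n + i)) = - (of_nat (Suc (n + i)) * W)"
      unfolding t_def W_def sub choose_2_shift_up[OF i] e_def[symmetric] sym
      by (simp add: power_add mult_ac del: of_nat_Suc)
    ultimately have "t (n - i) + t (Suc (n + i)) = (of_nat (n - i) - of_nat (Suc (n + i))) * W"
      by (simp add: left_diff_distrib del: of_nat_Suc)
    also have "(of_nat (n - i) - of_nat (Suc (n + i)) :: int fps) = - of_nat (2*i+1)"
      using i by (simp add: of_nat_diff)
    finally show "t (n - i) + t (Suc (n + i)) = - ((-1) ^ n * X ^ e) *
      ((-1) ^ i * of_nat (2*i+1) * X ^ (Suc i choose 2) * qbinom X (2*n+1) (n - i))"
      by (simp only: W_def power_add mult_minus_left mult_minus_right mult_ac)
  qed
  also have "\<dots> = - ((-1) ^ n * X ^ e) * (\<Sum>i\<le>n. (-1) ^ i * of_nat (2*i+1) * X ^ (Suc i choose 2) * qbinom X (2*n+1) (n - i))"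
    by (simp only: sum_distrib_left)
  finally have "(\<Sum>k\<le>2*n+1. t k) = \<dots>" .
  moreover have "(\<Sum>k\<le>2*n+1. t k) = - ((-1) ^ n * X ^ e) * qfact X n ^ 2"
    unfolding t_def e_def mult_minus_left by (rule qbinomial_derivative)
  ultimately have "- ((-1) ^ n * X ^ e) * qfact X n ^ 2 = - ((-1) ^ n * X ^ e) *
      (\<Sum>i\<le>n. (-1) ^ i * of_nat (2*i+1) * X ^ (Suc i choose 2) * qbinom X (2*n+1) (n - i))"
    by (rule trans[OF sym, rotated])
  moreover have "- ((-1) ^ n * X ^ e) \<noteq> 0"
    unfolding neg_equal_0_iff_equal mult_eq_0_iff using fps_X_neq_zero[where 'a = int]
    by (auto simp only: power_eq_0_iff neg_equal_0_iff_equal one_neq_zero)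
  ultimately show ?thesis by (simp only: mult_cancel_left simp_thms)
qed

section \<open>Truncated congruences of power series\<close>

text \<open>
  Congruence modulo \<open>m\<close> of all coefficients up to order \<open>N\<close>. Infinite products are replaced
  throughout by finite ones that agree with them in this range.
\<close>
definition fps_cong :: "int \<Rightarrow> nat \<Rightarrow> int fps \<Rightarrow> int fps \<Rightarrow> bool" where
  "fps_cong m N F G \<longleftrightarrow> (\<forall>i\<le>N. [fps_nth F i = fps_nth G i] (mod m))"

lemma fps_cong_refl [simp]: "fps_cong m N F F"
  by (simp add: fps_cong_def)

lemma fps_cong_sym: "fps_cong m N F G \<Longrightarrow> fps_cong m N G F"
  by (simp add: fps_cong_def cong_sym)

lemma fps_cong_trans [trans]: "fps_cong m N F G \<Longrightarrow> fps_cong m N G H \<Longrightarrow> fps_cong m N F H"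
  unfolding fps_cong_def by (meson cong_trans)

lemma fps_cong_mult:
  "fps_cong m N F G \<Longrightarrow> fps_cong m N F' G' \<Longrightarrow> fps_cong m N (F * F') (G * G')"
  unfolding fps_cong_def by (auto simp: fps_mult_nth intro!: cong_sum cong_mult)

lemma fps_cong_sum:
  "(\<And>x. x \<in> A \<Longrightarrow> fps_cong m N (F x) (G x)) \<Longrightarrow> fps_cong m N (sum F A) (sum G A)"
  unfolding fps_cong_def by (auto simp: fps_sum_nth intro!: cong_sum)

lemma fps_cong_prod:
  "(\<And>x. x \<in> A \<Longrightarrow> fps_cong m N (F x) (G x)) \<Longrightarrow> fps_cong m N (prod F A) (prod G A)"
  by (induction A rule: infinite_finite_induct) (auto intro: fps_cong_mult)

lemma fps_cong_power: "fps_cong m N F G \<Longrightarrow> fps_cong m N (F ^ k) (G ^ k)"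
  by (induction k) (auto intro: fps_cong_mult)

lemma fps_cong_cancel:
  assumes "fps_cong m N (E * F) (E * G)" "E * E' = 1"
  shows "fps_cong m N F G"
proof -
  have "E' * E = 1" using assms(2) by (simp only: mult.commute)
  then have "E' * (E * H) = H" for H by (simp only: mult.assoc[symmetric] mult_1)
  with fps_cong_mult[OF fps_cong_refl assms(1), of E'] show ?thesis by (simp only:)
qed

lemma fps_cong_X_power_mult: "N < k \<Longrightarrow> fps_cong m N (X ^ k * F) 0"
  by (simp add: fps_cong_def fps_X_power_mult_nth)

lemma fps_cong_one_minus_X_power: "N < k \<Longrightarrow> fps_cong m N (1 - X ^ k) 1"
  by (simp add: fps_cong_def)

section \<open>Jacobi's identity modulo a power of the variable\<close>

lemma fps_cong_qfact: "N \<le> n \<Longrightarrow> fps_cong m N (qfact X n) (qfact X N)"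
proof (induction n rule: dec_induct)
  case (step n)
  have "fps_cong m N (qfact X (Suc n)) (1 * qfact X N)"
    unfolding qfact_Suc using step by (intro fps_cong_mult fps_cong_one_minus_X_power) auto
  then show ?case by simp
qed simp

definition partition_series :: "nat set \<Rightarrow> int fps" where
  "partition_series S = Abs_fps (\<lambda>n. int (card (partitions_with S n)))"

lemma prod_mult_partition_series:
  assumes "finite S" "0 \<notin> S"
  shows "(\<Prod>k\<in>S. 1 - X ^ k) * partition_series S = 1"
  using assms
proof (induction S rule: finite_induct)
  case empty
  have "partitions_with {} n = (if n = 0 then {{#}} else {})" for n
    by (auto simp: partitions_with_def)
  then show ?case by (auto simp: partition_series_def intro!: fps_ext)
next
  case (insert k S)
  have step: "(1 - X ^ k) * partition_series (insert k S) = partition_series S"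
    using card_partitions_with_insert[of S k] insert
    by (intro fps_ext) (auto simp: partition_series_def algebra_simps fps_X_power_mult_nth)
  have "(\<Prod>j\<in>insert k S. 1 - X ^ j) * partition_series (insert k S) =
      (\<Prod>j\<in>S. 1 - X ^ j) * ((1 - X ^ k) * partition_series (insert k S))"
    using insert.hyps by (simp add: mult_ac)
  also have "\<dots> = 1" unfolding step using insert by simp
  finally show ?case .
qed

text \<open>Euler's product is invertible over the integers, so it may be cancelled from congruences.\<close>
lemma qfact_mult_partition_series: "qfact X n * partition_series {1..n} = 1"
  unfolding qfact_def by (rule prod_mult_partition_series) auto

text \<open>
  Up to order \<open>N\<close> all the products \<open>qfact X n\<close> with \<open>n \<ge> N\<close> agree with Euler's product. The level
  \<open>2 N\<close> in the finite identity ensures that for \<open>i \<le> N\<close> the q-binomial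
  coefficient is a quotient \<open>E / (E * E)\<close> of such products, and the terms with \<open>i > N\<close>
  have order above \<open>N\<close>.
\<close>
theorem jacobi_cube:
  "fps_cong m N (qfact X N ^ 3) (\<Sum>i\<le>2*N. (-1) ^ i * of_nat (2*i+1) * X ^ (Suc i choose 2))"
proof -
  define E where "E = qfact X N"
  have "fps_cong m N (E ^ 2 * E) (qfact X (2*N) ^ 2 * E)"
    unfolding E_def
    by (intro fps_cong_mult fps_cong_power fps_cong_refl fps_cong_sym[OF fps_cong_qfact]) auto
  also have "qfact X (2*N) ^ 2 * E =
      (\<Sum>i\<le>2*N. (-1) ^ i * of_nat (2*i+1) * X ^ (Suc i choose 2) * (qbinom X (2*(2*N)+1) (2*N - i) * E))"
    by (simp only: finite_jacobi_cube sum_distrib_right mult.assoc)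
  also have "fps_cong m N \<dots> (\<Sum>i\<le>2*N. (-1) ^ i * of_nat (2*i+1) * X ^ (Suc i choose 2))"
  proof (rule fps_cong_sum)
    fix i assume "i \<in> {..2*N}"
    then have i: "i \<le> 2*N" by simp
    define Q where "Q = qbinom X (2*(2*N)+1) (2*N - i)"
    show "fps_cong m N ((-1) ^ i * of_nat (2*i+1) * X ^ (Suc i choose 2) * (Q * E))
       ((-1) ^ i * of_nat (2*i+1) * X ^ (Suc i choose 2))"
    proof (cases "i \<le> N")
      case True
      have "qbinom X ((2*N - i) + (2*N + 1 + i)) (2*N - i) * (qfact X (2*N - i) * qfact X (2*N + 1 + i)) =
              qfact X ((2*N - i) + (2*N + 1 + i))"
        by (rule qbinom_mult_qfact)
      also have "(2*N - i) + (2*N + 1 + i) = 2*(2*N)+1" using i by simp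
      finally have *: "Q * (qfact X (2*N - i) * qfact X (2*N + 1 + i)) = qfact X (2*(2*N)+1)"
        by (simp only: Q_def)
      have "fps_cong m N (Q * (E * E)) (Q * (qfact X (2*N - i) * qfact X (2*N + 1 + i)))"
        unfolding E_def using True
        by (intro fps_cong_mult fps_cong_refl fps_cong_sym[OF fps_cong_qfact]) auto
      also have "fps_cong m N \<dots> E"
        unfolding * E_def by (rule fps_cong_qfact) auto
      finally have "fps_cong m N (E * (Q * E)) (E * 1)" by (simp add: mult_ac)
      then have "fps_cong m N (Q * E) 1"
        unfolding E_def by (rule fps_cong_cancel) (rule qfact_mult_partition_series)
      from fps_cong_mult[OF fps_cong_refl this]
      show ?thesis by (metis mult.right_neutral)
    next
      case False
      have "Suc i choose 2 = (i choose 2) + i" by (simp add: numeral_2_eq_2)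
      with False have big: "N < Suc i choose 2" by simp
      have "fps_cong m N (X ^ (Suc i choose 2) * ((-1) ^ i * of_nat (2*i+1) * (Q * E))) 0"
           "fps_cong m N (X ^ (Suc i choose 2) * ((-1) ^ i * of_nat (2*i+1))) 0"
        using big by (rule fps_cong_X_power_mult)+
      from fps_cong_trans[OF this(1) fps_cong_sym[OF this(2)]] show ?thesis
        by (simp only: mult_ac)
    qed
  qed
  finally show ?thesis by (simp add: E_def power3_eq_cube power2_eq_square)
qed

section \<open>Regular partitions modulo a prime\<close>

text \<open>
  The Frobenius map: the inner binomial coefficients are divisible by \<open>p\<close>, and \<open>p\<close> is odd for the
  sign of the last term.
\<close>
lemma fps_cong_one_minus_power_prime:
  assumes "prime p" "odd p"
  shows "fps_cong (int p) N ((1 - F) ^ p) (1 - F ^ p)"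
proof -
  have p: "p > 0" using assms(1) by (rule prime_gt_0_nat)
  have "(1 - F) ^ p = ((- F) + 1) ^ p" by simp
  also have "\<dots> = (\<Sum>k\<le>p. of_nat (p choose k) * (- F) ^ k)"
    by (subst binomial_ring) simp
  also have "fps_cong (int p) N \<dots> (\<Sum>k\<le>p. if k \<in> {0, p} then (- F) ^ k else 0)"
  proof (rule fps_cong_sum)
    fix k assume "k \<in> {..p}"
    show "fps_cong (int p) N (of_nat (p choose k) * (- F) ^ k) (if k \<in> {0, p} then (- F) ^ k else 0)"
    proof (cases "k \<in> {0, p}")
      case True
      then show ?thesis by auto
    next
      case False
      then have "p dvd (p choose k)"
        using \<open>k \<in> {..p}\<close> assms(1) by (intro dvd_choose_prime) auto
      then have "int p dvd int (p choose k)" by (simp only: of_nat_dvd_iff)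
      then show ?thesis
        using False by (simp add: fps_cong_def fps_mult_of_nat_nth cong_0_iff)
    qed
  qed
  also have "(\<Sum>k\<le>p. if k \<in> {0, p} then (- F) ^ k else 0) = (\<Sum>k\<in>{0, p}. (- F) ^ k)"
    by (rule sum.mono_neutral_cong_right) auto
  also have "\<dots> = 1 - F ^ p" using p assms(2) by simp
  finally show ?thesis .
qed

text \<open>
  The generating function of the \<open>p\<close>-regular partitions times Euler's product \<open>E\<close> is \<open>E\<close> with \<open>X\<close>
  replaced by \<open>X ^ p\<close>, which modulo \<open>p\<close> is \<open>E ^ p\<close>. Everything is truncated at \<open>n\<close>: only parts
  up to \<open>n\<close> and only factors with \<open>p * k \<le> n\<close> matter.
\<close>
lemma b_prime_cong_qfact_power:
  assumes "prime p" "odd p"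
  shows "[int (b p (int n)) = fps_nth (qfact X n ^ (p - 1)) n] (mod int p)"
proof -
  define S where "S = {k\<in>{1..n}. \<not> p dvd k}"
  define D where "D = {k\<in>{1..n}. p dvd k}"
  have p: "p > 0" using assms(1) by (rule prime_gt_0_nat)
  have fin: "finite S" "finite D" by (simp_all add: S_def D_def)
  have split: "qfact X n = (\<Prod>k\<in>S. 1 - X ^ k) * (\<Prod>k\<in>D. 1 - X ^ k)"
  proof -
    have "{1..n} = S \<union> D" "S \<inter> D = {}" by (auto simp: S_def D_def)
    then show ?thesis unfolding qfact_def using fin by (metis prod.union_disjoint)
  qed
  have "qfact X n * partition_series S =
     ((\<Prod>k\<in>S. 1 - X ^ k) * partition_series S) * (\<Prod>k\<in>D. 1 - X ^ k)"
    by (simp add: split mult_ac)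
  also have "(\<Prod>k\<in>S. 1 - X ^ k) * partition_series S = 1"
    using fin by (intro prod_mult_partition_series) (auto simp: S_def)
  also have "1 * (\<Prod>k\<in>D. 1 - X ^ k) = (\<Prod>k\<in>{k\<in>{1..n}. p * k \<le> n}. 1 - X ^ (p * k))"
    unfolding mult_1
  proof (rule prod.reindex_bij_witness[of _ "\<lambda>k. p * k" "\<lambda>k. k div p"])
    fix k assume k: "k \<in> D"
    then obtain j where j: "k = p * j" by (auto simp: D_def)
    have "j \<le> k" using j p by simp
    then have "j \<le> n" using k by (simp add: D_def)
    with k j p show "p * (k div p) = k" "k div p \<in> {k\<in>{1..n}. p * k \<le> n}"
      "1 - X ^ (p * (k div p)) = 1 - X ^ k"
      by (auto simp: D_def)
  next
    fix k assume "k \<in> {k\<in>{1..n}. p * k \<le> n}"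
    with p show "p * k div p = k" "p * k \<in> D" by (auto simp: D_def)
  qed
  also have "\<dots> = (\<Prod>k=1..n. if p * k \<le> n then 1 - X ^ (p * k) else 1)"
    by (rule prod.inter_filter) simp
  also have "fps_cong (int p) n \<dots> (\<Prod>k=1..n. (1 - X ^ k) ^ p)"
  proof (rule fps_cong_prod)
    fix k
    have "fps_cong (int p) n (if p * k \<le> n then 1 - X ^ (p * k) else 1) (1 - (X ^ k) ^ p)"
      using fps_cong_sym[OF fps_cong_one_minus_X_power[of n "p * k" "int p"]]
      by (auto simp: power_mult[symmetric] mult.commute)
    also have "fps_cong (int p) n \<dots> ((1 - X ^ k) ^ p)"
      by (rule fps_cong_sym[OF fps_cong_one_minus_power_prime[OF assms]])
    finally show "fps_cong (int p) n (if p * k \<le> n then 1 - X ^ (p * k) else 1) ((1 - X ^ k) ^ p)" .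
  qed
  also have "(\<Prod>k=1..n. (1 - X ^ k) ^ p) = qfact X n ^ p"
    by (simp only: qfact_def prod_power_distrib)
  also have "qfact X n ^ p = qfact X n * qfact X n ^ (p - 1)"
    using p by (cases p) simp_all
  finally have "fps_cong (int p) n (partition_series S) (qfact X n ^ (p - 1))"
    by (rule fps_cong_cancel) (rule qfact_mult_partition_series)
  moreover have "fps_nth (partition_series S) n = int (b p (int n))"
  proof -
    have "partitions_with S n = partitions_with (regular_parts p) n"
      using member_le_sum_mset by (fastforce simp: partitions_with_def S_def regular_parts_def)
    then show ?thesis by (simp add: partition_series_def b_def)
  qed
  ultimately show ?thesis unfolding fps_cong_def by (metis order_refl)
qed

section \<open>Quaternions and the theta coefficients\<close>

text \<open>\<open>(a, b, c, d)\<close> stands for the Lipschitz quaternion \<open>a + b i + c j + d k\<close>.\<close>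
type_synonym quat = "int \<times> int \<times> int \<times> int"

fun qmul :: "quat \<Rightarrow> quat \<Rightarrow> quat" where
  "qmul (p0, p1, p2, p3) (q0, q1, q2, q3) =
     (p0*q0 - p1*q1 - p2*q2 - p3*q3, p0*q1 + p1*q0 + p2*q3 - p3*q2,
      p0*q2 - p1*q3 + p2*q0 + p3*q1, p0*q3 + p1*q2 - p2*q1 + p3*q0)"

fun qconj :: "quat \<Rightarrow> quat" where
  "qconj (q0, q1, q2, q3) = (q0, - q1, - q2, - q3)"

fun qnorm :: "quat \<Rightarrow> int" where
  "qnorm (q0, q1, q2, q3) = q0^2 + q1^2 + q2^2 + q3^2"

fun qscale :: "int \<Rightarrow> quat \<Rightarrow> quat" where
  "qscale m (q0, q1, q2, q3) = (m*q0, m*q1, m*q2, m*q3)"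

fun qdiv :: "quat \<Rightarrow> int \<Rightarrow> quat" where
  "qdiv (q0, q1, q2, q3) m = (q0 div m, q1 div m, q2 div m, q3 div m)"

fun qdvd :: "int \<Rightarrow> quat \<Rightarrow> bool" where
  "qdvd m (q0, q1, q2, q3) \<longleftrightarrow> m dvd q0 \<and> m dvd q1 \<and> m dvd q2 \<and> m dvd q3"

fun coord_prod :: "quat \<Rightarrow> int" where
  "coord_prod (q0, q1, q2, q3) = q0 * q1 * q2 * q3"

fun one_mod4 :: "quat \<Rightarrow> bool" where
  "one_mod4 (q0, q1, q2, q3) \<longleftrightarrow> q0 mod 4 = 1 \<and> q1 mod 4 = 1 \<and> q2 mod 4 = 1 \<and> q3 mod 4 = 1"

text \<open>
  This normalisation selects one of the eight unit multiples \<open>p u\<close> of a quaternion \<open>p\<close> with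
  one odd and three even coordinates, and it makes left multiplication by \<open>p\<close> preserve
  \<open>one_mod4\<close>.
\<close>
fun primary :: "quat \<Rightarrow> bool" where
  "primary (q0, q1, q2, q3) \<longleftrightarrow>
     even q1 \<and> even q2 \<and> even q3 \<and> (q0 + q1 + q2 + q3) mod 4 = 1"

lemma qnorm_qmul: "qnorm (qmul p x) = qnorm p * qnorm x"
  by (cases p; cases x) (simp add: power2_eq_square algebra_simps)

lemma qnorm_qconj [simp]: "qnorm (qconj p) = qnorm p"
  by (cases p) simp

lemma qnorm_qscale: "qnorm (qscale m x) = m^2 * qnorm x"
  by (cases x) (simp add: power_mult_distrib algebra_simps)

lemma qconj_qmul_qmul: "qmul (qconj p) (qmul p x) = qscale (qnorm p) x"
  by (cases p; cases x) (simp add: power2_eq_square algebra_simps)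

lemma qmul_qconj_qmul: "qmul p (qmul (qconj p) x) = qscale (qnorm p) x"
  by (cases p; cases x) (simp add: power2_eq_square algebra_simps)

lemma qmul_qscale: "qmul p (qscale m x) = qscale m (qmul p x)"
  by (cases p; cases x) (simp add: algebra_simps)

lemma qdvd_qscale: "qdvd m (qscale m x)"
  by (cases x) simp

lemma qscale_qdiv: "qdvd m x \<Longrightarrow> qscale m (qdiv x m) = x"
  by (cases x) simp

lemma qdiv_qscale: "m \<noteq> 0 \<Longrightarrow> qdiv (qscale m x) m = x"
  by (cases x) simp

lemma qscale_inject: "m \<noteq> 0 \<Longrightarrow> qscale m x = qscale m y \<longleftrightarrow> x = y"
  by (cases x; cases y) simp

lemma primary_qconj: "primary p \<Longrightarrow> primary (qconj p)"
proof (cases p)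
  case (fields a b c d)
  assume "primary p"
  with fields show ?thesis by simp presburger
qed

text \<open>
  Modulo 4, an even coefficient times an odd number depends on the coefficient only, and its sign does not
  matter. So every coordinate of \<open>p x\<close> is congruent to the coordinate sum of \<open>p\<close>.
\<close>
lemma one_mod4_qmul:
  assumes "primary p" "one_mod4 x"
  shows "one_mod4 (qmul p x)"
proof -
  obtain a b c d where p: "p = (a, b, c, d)" by (cases p)
  obtain e f g h where x: "x = (e, f, g, h)" by (cases x)
  have ex: "\<exists>k. y = 4 * k + 1" if "y mod 4 = 1" for y :: int
    using that by presburger
  have mod1: "y mod 4 = 1" if "y = 4 * k + 1" for y k :: int
    using that by presburger
  obtain e' f' g' h' where x': "e = 4*e' + 1" "f = 4*f' + 1" "g = 4*g' + 1" "h = 4*h' + 1"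
    using assms x ex by fastforce
  obtain b' c' d' t where p': "b = 2*b'" "c = 2*c'" "d = 2*d'" "a + b + c + d = 4*t + 1"
    using assms(1) p ex[of "a + b + c + d"] by (auto elim!: evenE)
  have a': "a = 4*t + 1 - 2*b' - 2*c' - 2*d'" using p' by simp
  have "(a*e - b*f - c*g - d*h) mod 4 = 1"
    by (rule mod1[of _ "t + a*e' - b*f' - c*g' - d*h' - b' - c' - d'"])
      (simp add: x' p' a' algebra_simps)
  moreover have "(a*f + b*e + c*h - d*g) mod 4 = 1"
    by (rule mod1[of _ "t + a*f' + b*e' + c*h' - d*g' - d'"])
      (simp add: x' p' a' algebra_simps)
  moreover have "(a*g - b*h + c*e + d*f) mod 4 = 1"
    by (rule mod1[of _ "t + a*g' - b*h' + c*e' + d*f' - b'"])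
      (simp add: x' p' a' algebra_simps)
  moreover have "(a*h + b*g - c*f + d*e) mod 4 = 1"
    by (rule mod1[of _ "t + a*h' + b*g' - c*f' + d*e' - c'"])
      (simp add: x' p' a' algebra_simps)
  ultimately show ?thesis by (simp add: p x)
qed

definition quats :: "int \<Rightarrow> quat set" where
  "quats M = {x. one_mod4 x \<and> qnorm x = M}"

definition theta :: "int \<Rightarrow> int" where
  "theta M = (\<Sum>x\<in>quats M. coord_prod x)"

lemma abs_le_of_sum_squares:
  fixes a :: int
  assumes "a^2 + r = M" "r \<ge> 0"
  shows "\<bar>a\<bar> \<le> M"
proof -
  have "\<bar>a\<bar> \<le> \<bar>a\<bar> * \<bar>a\<bar>"
    using mult_left_mono[of 1 "\<bar>a\<bar>" "\<bar>a\<bar>"] by (cases "a = 0") auto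
  then have "\<bar>a\<bar> \<le> a^2" by (simp only: abs_mult_self_eq power2_eq_square)
  with assms show ?thesis by linarith
qed

lemma finite_quats: "finite (quats M)"
proof -
  have "quats M \<subseteq> {-M..M} \<times> {-M..M} \<times> {-M..M} \<times> {-M..M}"
  proof
    fix x assume x: "x \<in> quats M"
    obtain a b c d where [simp]: "x = (a, b, c, d)" by (cases x)
    have s: "a^2 + b^2 + c^2 + d^2 = M" using x by (simp add: quats_def)
    have "\<bar>a\<bar> \<le> M" "\<bar>b\<bar> \<le> M" "\<bar>c\<bar> \<le> M" "\<bar>d\<bar> \<le> M"
      by (rule abs_le_of_sum_squares[of _ "b^2 + c^2 + d^2"]
            abs_le_of_sum_squares[of _ "a^2 + c^2 + d^2"]
            abs_le_of_sum_squares[of _ "a^2 + b^2 + d^2"]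
            abs_le_of_sum_squares[of _ "a^2 + b^2 + c^2"];
          use s in \<open>simp add: algebra_simps\<close>)+
    then show "x \<in> {-M..M} \<times> {-M..M} \<times> {-M..M} \<times> {-M..M}" by auto
  qed
  then show ?thesis by (rule finite_subset) simp
qed

definition odd_roots :: "nat \<Rightarrow> int set" where
  "odd_roots N = {x. x mod 4 = 1 \<and> \<bar>x\<bar> \<le> 4 * int N + 1}"

text \<open>For odd \<open>x\<close> the division is exact and the value is a triangular number.\<close>
definition theta_exp :: "int \<Rightarrow> nat" where
  "theta_exp x = nat ((x^2 - 1) div 8)"

lemma theta_exp: "odd x \<Longrightarrow> x^2 = 8 * int (theta_exp x) + 1"
proof -
  assume "odd x"
  then obtain y where y: "x = 2*y + 1" by (elim oddE)
  have "even (y * (y + 1))" by simp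
  then obtain z where z: "y * (y + 1) = 2 * z" by (elim evenE)
  have "x^2 = 8*z + 1" using z by (simp add: y power2_eq_square algebra_simps)
  moreover have "x^2 \<ge> 0" by simp
  ultimately show ?thesis by (simp add: theta_exp_def)
qed

text \<open>
  The odd numbers \<open>(-1)^i (2i + 1)\<close> are exactly the integers congruent to 1 modulo 4, so the signs in
  Jacobi's series disappear.
\<close>
lemma jacobi_series_eq_theta:
  "(\<Sum>i\<le>2*N. (-1) ^ i * of_nat (2*i+1) * X ^ (Suc i choose 2)) =
     (\<Sum>x\<in>odd_roots N. of_int x * X ^ theta_exp x)"
proof (rule sum.reindex_bij_witness[of _ "\<lambda>x. nat ((\<bar>x\<bar> - 1) div 2)" "\<lambda>i. (-1) ^ i * (2 * int i + 1)"])
  fix i :: nat assume i: "i \<in> {..2*N}"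
  let ?x = "(-1) ^ i * (2 * int i + 1)"
  show "nat ((\<bar>?x\<bar> - 1) div 2) = i" by (simp add: abs_mult)
  have "?x mod 4 = 1"
    by (cases "even i") (auto elim!: evenE oddE, presburger+)
  then show "?x \<in> odd_roots N" using i by (auto simp: odd_roots_def abs_mult)
  have "odd ?x" by simp
  then have "8 * int (theta_exp ?x) + 1 = ?x^2" by (rule theta_exp[symmetric])
  also have "\<dots> = (2 * int i + 1)^2"
    by (cases "even i") (simp_all add: power2_eq_square algebra_simps)
  finally have "8 * int (theta_exp ?x) + 1 = (2 * int i + 1)^2" .
  moreover have "8 * int (Suc i choose 2) + 1 = (2 * int i + 1)^2"
  proof -
    have "int (2 * (Suc i choose 2) + Suc i) = int (Suc i * Suc i)"
      by (simp only: two_choose_two)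
    then show ?thesis by (simp add: power2_eq_square algebra_simps)
  qed
  ultimately have "theta_exp ?x = Suc i choose 2" by linarith
  then show "of_int ?x * X ^ theta_exp ?x = (-1) ^ i * of_nat (2*i+1) * X ^ (Suc i choose 2)"
    by (simp add: mult_ac)
next
  fix x assume x: "x \<in> odd_roots N"
  show "nat ((\<bar>x\<bar> - 1) div 2) \<in> {..2*N}" using x by (auto simp: odd_roots_def)
  show "(-1) ^ nat ((\<bar>x\<bar> - 1) div 2) * (2 * int (nat ((\<bar>x\<bar> - 1) div 2)) + 1) = x"
  proof (cases "x \<ge> 0")
    case True
    define y where "y = nat (x div 4)"
    have x_eq: "x = 4 * int y + 1" using x True unfolding y_def odd_roots_def by simp presburger
    then have "nat ((\<bar>x\<bar> - 1) div 2) = 2 * y" by simp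
    then show ?thesis using x_eq by simp
  next
    case False
    define y where "y = nat (- (x div 4) - 1)"
    have "x = - (4 * int y + 3)" using x False unfolding y_def odd_roots_def by simp presburger
    then have "nat ((\<bar>x\<bar> - 1) div 2) = 2 * y + 1" "x = - (4 * int y + 3)" by simp_all
    then show ?thesis by simp
  qed
qed

text \<open>
  The exponents \<open>(x^2 - 1) / 8\<close> of four roots add up to \<open>n\<close> exactly when their
  squares add up to \<open>8 n + 4\<close>, that is, when the quaternion formed from them has that norm.
\<close>
lemma theta_series_power_4:
  assumes "n \<le> N"
  shows "fps_nth ((\<Sum>x\<in>odd_roots N. of_int x * X ^ theta_exp x) ^ 4) n = theta (8 * int n + 4)"
proof -
  define S where "S = odd_roots N"
  define J where "J = (\<Sum>x\<in>S. of_int x * X ^ theta_exp x)"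
  let ?e = "\<lambda>(x, y, z, w). theta_exp x + (theta_exp y + (theta_exp z + theta_exp w))"
  have "J ^ 4 = J * (J * (J * J))" by (simp add: eval_nat_numeral)
  also have "\<dots> = (\<Sum>q\<in>S \<times> S \<times> S \<times> S. of_int (coord_prod q) * X ^ ?e q)"
    unfolding J_def sum_product sum.cartesian_product
    by (intro sum.cong) (auto simp: power_add mult_ac)
  finally have "fps_nth (J ^ 4) n = (\<Sum>q\<in>S \<times> S \<times> S \<times> S. if n = ?e q then coord_prod q else 0)"
    by (simp add: fps_sum_nth fps_mult_of_int_nth case_prod_unfold if_distrib cong: if_cong)
  also have "\<dots> = (\<Sum>q\<in>quats (8 * int n + 4). coord_prod q)"
  proof (rule sum.mono_neutral_cong_right)
    show "finite (S \<times> S \<times> S \<times> S)"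
    proof -
      have "S \<subseteq> {- (4 * int N + 1)..4 * int N + 1}" by (auto simp: S_def odd_roots_def)
      then have "finite S" by (rule finite_subset) simp
      then show ?thesis by simp
    qed
    have odd: "x mod 4 = 1 \<Longrightarrow> odd x" for x :: int by presburger
    have norm: "qnorm q = 8 * int (?e q) + 4" if "one_mod4 q" for q
      using that by (cases q) (auto simp: theta_exp odd)
    show "quats (8 * int n + 4) \<subseteq> S \<times> S \<times> S \<times> S"
    proof
      fix q assume q: "q \<in> quats (8 * int n + 4)"
      obtain x y z w where [simp]: "q = (x, y, z, w)" by (cases q)
      have e: "n = ?e q" "one_mod4 q" using q norm[of q] by (auto simp: quats_def)
      have "t \<in> S" if "t mod 4 = 1" "theta_exp t \<le> n" for t
      proof -
        have "t^2 = 8 * int (theta_exp t) + 1" using that by (simp add: theta_exp odd)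
        also have "\<dots> \<le> 16 * (int N * int N) + 8 * int N + 1"
        proof -
          have "int (theta_exp t) \<le> int N" using that assms by simp
          moreover have "0 \<le> int N * int N" by simp
          ultimately show ?thesis by linarith
        qed
        also have "\<dots> = (4 * int N + 1)^2" by (simp add: power2_eq_square algebra_simps)
        finally have "\<bar>t\<bar> \<le> 4 * int N + 1"
          by (rule power2_le_imp_le[of "\<bar>t\<bar>", unfolded power2_abs]) simp
        then show ?thesis using that by (simp add: S_def odd_roots_def)
      qed
      then show "q \<in> S \<times> S \<times> S \<times> S" using e by auto
    qed
    show "\<forall>q\<in>S \<times> S \<times> S \<times> S - quats (8 * int n + 4). (if n = ?e q then coord_prod q else 0) = 0"
    proof
      fix q assume q: "q \<in> S \<times> S \<times> S \<times> S - quats (8 * int n + 4)"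
      then have "one_mod4 q" by (auto simp: S_def odd_roots_def)
      then have "n \<noteq> ?e q" using norm[of q] q by (auto simp: quats_def)
      then show "(if n = ?e q then coord_prod q else 0) = 0" by simp
    qed
    show "(if n = ?e q then coord_prod q else 0) = coord_prod q" if "q \<in> quats (8 * int n + 4)" for q
      using that norm[of q] by (auto simp: quats_def)
  qed
  finally show ?thesis by (simp add: theta_def J_def S_def)
qed

text \<open>Here \<open>12 = 4 * 3\<close>: Euler's product to the 12th power is the fourth power of Jacobi's series.\<close>
theorem b_13_cong_theta: "[int (b 13 (int n)) = theta (8 * int n + 4)] (mod 13)"
proof -
  have "fps_cong 13 n ((qfact X n ^ 3) ^ 4) ((\<Sum>x\<in>odd_roots n. of_int x * X ^ theta_exp x) ^ 4)"
    unfolding jacobi_series_eq_theta[symmetric] by (intro fps_cong_power jacobi_cube)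
  then have "[fps_nth (qfact X n ^ 12) n = theta (8 * int n + 4)] (mod 13)"
    unfolding fps_cong_def theta_series_power_4[OF order_refl, symmetric] by (simp flip: power_mult)
  moreover have "[int (b 13 (int n)) = fps_nth (qfact X n ^ 12) n] (mod 13)"
    using b_prime_cong_qfact_power[of 13 n] by simp
  ultimately show ?thesis by (metis cong_trans)
qed

section \<open>The Hecke relation at 13\<close>

text \<open>
  Left multiplication by \<open>p\<close> is a bijection from the quaternions of norm \<open>M\<close> onto the left multiples
  of \<open>p\<close> of norm \<open>13 M\<close>, with inverse \<open>x \<mapsto> qconj p * x / 13\<close>.
\<close>
lemma sum_over_left_multiples:
  assumes p: "primary p" "qnorm p = 13"
  shows "(\<Sum>x\<in>{x \<in> quats (13 * M). qdvd 13 (qmul (qconj p) x)}. coord_prod x) =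
           (\<Sum>y\<in>quats M. coord_prod (qmul p y))"
proof (rule sum.reindex_bij_witness[of _ "qmul p" "\<lambda>x. qdiv (qmul (qconj p) x) 13"])
  fix x assume x: "x \<in> {x \<in> quats (13 * M). qdvd 13 (qmul (qconj p) x)}"
  define y where "y = qdiv (qmul (qconj p) x) 13"
  have y: "qscale 13 y = qmul (qconj p) x"
    using x by (simp add: y_def qscale_qdiv)
  have "qscale 13 (qmul p y) = qscale 13 x"
    by (metis y qmul_qscale qmul_qconj_qmul p(2))
  then show px: "qmul p (qdiv (qmul (qconj p) x) 13) = x"
    by (simp add: qscale_inject y_def)
  have "13^2 * qnorm y = 13 * (13 * M)"
    using x p by (metis (mono_tags, lifting) quats_def mem_Collect_eq qnorm_qconj qnorm_qmul qnorm_qscale y)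
  then have "qnorm y = M" by simp
  moreover have "one_mod4 y"
  proof -
    have "one_mod4 (qscale 13 y)"
      unfolding y using x p by (auto simp: quats_def intro: one_mod4_qmul primary_qconj)
    then show ?thesis by (cases y) (simp, presburger)
  qed
  ultimately show "qdiv (qmul (qconj p) x) 13 \<in> quats M" by (simp add: quats_def y_def)
  show "coord_prod (qmul p (qdiv (qmul (qconj p) x) 13)) = coord_prod x" by (simp only: px)
next
  fix y assume y: "y \<in> quats M"
  show "qdiv (qmul (qconj p) (qmul p y)) 13 = y"
    by (simp add: qconj_qmul_qmul p qdiv_qscale)
  show "qmul p y \<in> {x \<in> quats (13 * M). qdvd 13 (qmul (qconj p) x)}"
    using y p by (auto simp: quats_def qnorm_qmul qconj_qmul_qmul qdvd_qscale one_mod4_qmul)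
qed

text \<open>
  These are all the primary quaternions of norm 13. The entry with index \<open>k < 13\<close> belongs to the
  point \<open>(k : 1)\<close> of the projective line over the field with 13 elements and the last one to
  \<open>(1 : 0)\<close>, in the sense of \<open>annihilates\<close> below.
\<close>
definition primaries13 :: "quat list" where
  "primaries13 =
     [(3, -2, 0, 0), (3, 0, 0, 2), (-1, 2, 2, 2), (-1, 2, -2, 2), (-1, -2, -2, -2),
      (3, 0, 2, 0), (-1, -2, 2, -2), (-1, -2, -2, 2), (3, 0, -2, 0), (-1, -2, 2, 2),
      (-1, 2, 2, -2), (-1, 2, -2, -2), (3, 0, 0, -2), (3, 2, 0, 0)]"

lemma primaries13: "p \<in> set primaries13 \<Longrightarrow> primary p \<and> qnorm p = 13"
  by (auto simp: primaries13_def)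

text \<open>
  The list is closed under conjugation by \<open>i\<close>, \<open>j\<close>, \<open>k\<close> and by \<open>1 + i\<close>, \<open>1 + j\<close>, \<open>1 + k\<close>. Hence
  the quartic form in \<open>y\<close> on the left behaves like the product of the coordinates: multiplying \<open>y\<close> by
  \<open>i\<close>, \<open>j\<close> or \<open>k\<close> on either side leaves it unchanged, and conjugating \<open>y\<close> by \<open>1 + i\<close>, \<open>1 + j\<close> or
  \<open>1 + k\<close> changes its sign. Only multiples of that product do so. The factor is the Hecke
  eigenvalue.
\<close>
lemma sum_coord_prod_primaries13:
  "(\<Sum>p\<leftarrow>primaries13. coord_prod (qmul p y)) = -418 * coord_prod y"
proof (cases y)
  case (fields a b c d)
  show ?thesis
    unfolding primaries13_def fields by (simp add: algebra_simps)
qed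

text \<open>
  Modulo 13 the number 5 is a square root of \<open>-1\<close>, so
  \<open>A + B j \<mapsto> (A, B; -B', A')\<close> with \<open>A = a + 5 b\<close>, \<open>A' = a - 5 b\<close>, \<open>B = c + 5 d\<close>,
  \<open>B' = c - 5 d\<close> identifies quaternions modulo 13 with \<open>2 \<times> 2\<close> matrices, the norm
  becoming the determinant. The predicate says that the row vector \<open>(s, t)\<close> kills the matrix of the quaternion.
\<close>
definition annihilates :: "int \<Rightarrow> int \<Rightarrow> quat \<Rightarrow> bool" where
  "annihilates s t = (\<lambda>(e, f, g, h).
     13 dvd s * (e + 5 * f) - t * (g - 5 * h) \<and> 13 dvd s * (g + 5 * h) + t * (e - 5 * f))"

lemma qdvd_13_iff:
  "qdvd 13 (u, v, w, z) \<longleftrightarrow>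
     13 dvd u + 5 * v \<and> 13 dvd u - 5 * v \<and> 13 dvd w + 5 * z \<and> 13 dvd w - 5 * z"
  unfolding qdvd.simps by presburger

text \<open>
  The matrix of the conjugate of \<open>(a, b, c, d)\<close> has rows \<open>(a - 5 b, - (c + 5 d))\<close> and \<open>(c - 5 d, a + 5 b)\<close>.
  By hypothesis these are \<open>l\<close> and \<open>m\<close> times the row \<open>(s, t)\<close> and not both zero, so the product
  with the matrix of \<open>x\<close> vanishes exactly when \<open>(s, t)\<close> kills that matrix.
\<close>
lemma qdvd_qconj_qmul_iff_annihilates:
  fixes a b c d :: int
  assumes "[a - 5 * b = l * s] (mod 13)" "[c + 5 * d = - l * t] (mod 13)"
    and "[c - 5 * d = m * s] (mod 13)" "[a + 5 * b = m * t] (mod 13)"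
    and "\<not> (13 dvd l \<and> 13 dvd m)"
  shows "qdvd 13 (qmul (qconj (a, b, c, d)) x) \<longleftrightarrow> annihilates s t x"
proof (cases x)
  case (fields e f g h)
  define p where "p = s * (e + 5 * f) - t * (g - 5 * h)"
  define q where "q = s * (g + 5 * h) + t * (e - 5 * f)"
  obtain u v w z where uvwz: "qmul (qconj (a, b, c, d)) x = (u, v, w, z)"
    by (cases "qmul (qconj (a, b, c, d)) x")
  have eqs: "u = a*e + b*f + c*g + d*h" "v = a*f - b*e - c*h + d*g"
            "w = a*g + b*h - c*e - d*f" "z = a*h - b*g + c*f - d*e"
    using uvwz by (auto simp: fields)
  \<comment> \<open>Writing \<open>5^2\<close> as \<open>-1 + 26\<close> turns the entries of the matrix product into the coordinates.\<close>
  have shift: "[26 * y + r = r] (mod 13)" for y r :: int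
    by (simp add: cong_iff_dvd_diff)
  have "u + 5 * v = 26*(b*f + d*h) + ((a - 5 * b)*(e + 5 * f) + (c + 5 * d)*(g - 5 * h))"
    by (simp add: eqs algebra_simps)
  also have "[\<dots> = (l * s)*(e + 5 * f) + (-l*t)*(g - 5 * h)] (mod 13)"
    by (rule cong_trans[OF shift]) (intro cong_add cong_mult assms cong_refl)
  finally have 1: "[u + 5 * v = l*p] (mod 13)" by (simp add: p_def algebra_simps)
  have "u - 5 * v = 26*(b*f + d*h) + ((a + 5 * b)*(e - 5 * f) + (c - 5 * d)*(g + 5 * h))"
    by (simp add: eqs algebra_simps)
  also have "[\<dots> = (m*t)*(e - 5 * f) + (m * s)*(g + 5 * h)] (mod 13)"
    by (rule cong_trans[OF shift]) (intro cong_add cong_mult assms cong_refl)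
  finally have 2: "[u - 5 * v = m*q] (mod 13)" by (simp add: q_def algebra_simps)
  have "w + 5 * z = 26*(b*h - d*f) + ((a - 5 * b)*(g + 5 * h) - (c + 5 * d)*(e - 5 * f))"
    by (simp add: eqs algebra_simps)
  also have "[\<dots> = (l * s)*(g + 5 * h) - (-l*t)*(e - 5 * f)] (mod 13)"
    by (rule cong_trans[OF shift]) (intro cong_diff cong_mult assms cong_refl)
  finally have 3: "[w + 5 * z = l*q] (mod 13)" by (simp add: q_def algebra_simps)
  have "w - 5 * z = 26*(b*h - d*f) + ((a + 5 * b)*(g - 5 * h) - (c - 5 * d)*(e + 5 * f))"
    by (simp add: eqs algebra_simps)
  also have "[\<dots> = (m*t)*(g - 5 * h) - (m * s)*(e + 5 * f)] (mod 13)"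
    by (rule cong_trans[OF shift]) (intro cong_diff cong_mult assms cong_refl)
  finally have 4: "[w - 5 * z = - m*p] (mod 13)" by (simp add: p_def algebra_simps)
  have p13: "prime (13 :: int)" by simp
  have "qdvd 13 (u, v, w, z) \<longleftrightarrow> 13 dvd l*p \<and> 13 dvd m*q \<and> 13 dvd l*q \<and> 13 dvd - m*p"
    unfolding qdvd_13_iff using 1 2 3 4 by (simp only: cong_dvd_iff)
  also have "\<dots> \<longleftrightarrow> 13 dvd p \<and> 13 dvd q"
    using assms(5) by (auto simp: prime_dvd_mult_iff[OF p13])
  finally show ?thesis
    unfolding uvwz by (simp add: annihilates_def fields p_def q_def)
qed

text \<open>
  A nonzero singular matrix over the field with 13 elements is killed by exactly one of the 14
  points of the projective line, while the zero matrix is killed by all 14, and \<open>14\<close> is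
  congruent to \<open>1\<close>.
\<close>
lemma annihilator_count_cong_1:
  assumes "13 dvd qnorm x"
  shows "[(\<Sum>k\<in>{0..<13}. of_bool (annihilates k 1 x)) +
            of_bool (annihilates 1 0 x) = (1 :: int)] (mod 13)"
proof -
  obtain e f g h where x: "x = (e, f, g, h)" by (cases x)
  define C C' D D' where CD: "C = e + 5 * f" "C' = e - 5 * f" "D = g + 5 * h" "D' = g - 5 * h"
  have fin: "annihilates k 1 x \<longleftrightarrow> 13 dvd k*C - D' \<and> 13 dvd k*D + C'" for k
    by (simp add: annihilates_def x CD)
  have inf: "annihilates 1 0 x \<longleftrightarrow> 13 dvd C \<and> 13 dvd D"
    by (simp add: annihilates_def x CD)
  have det: "13 dvd C*C' + D*D'"
  proof -
    have "C*C' + D*D' = qnorm x - 13 * (2*f^2 + 2*h^2)"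
      by (simp add: x CD algebra_simps power2_eq_square)
    then show ?thesis using assms by simp
  qed
  have p13: "prime (13 :: int)" by simp
  have solve: "\<exists>k0\<in>{0..<13}. \<forall>k\<in>{0..<13}. 13 dvd k*c - r \<longleftrightarrow> k = k0"
    if c: "\<not> 13 dvd c" for c r :: int
  proof -
    have "coprime c 13" using c p13 by (metis coprime_commute prime_imp_coprime)
    then obtain i where i: "[c * i = 1] (mod 13)" using cong_solve_coprime_int by blast
    have "13 dvd k*c - r \<longleftrightarrow> k = (r*i) mod 13" if "k \<in> {0..<13}" for k
    proof -
      have "13 dvd k*c - r \<longleftrightarrow> [k*c = r] (mod 13)" by (simp add: cong_iff_dvd_diff)
      also have "\<dots> \<longleftrightarrow> [k = r*i] (mod 13)"
      proof
        assume "[k*c = r] (mod 13)"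
        then have "[k*c*i = r*i] (mod 13)" by (rule cong_scalar_right)
        moreover have "[k*(c*i) = k*1] (mod 13)" using i by (rule cong_scalar_left)
        ultimately show "[k = r*i] (mod 13)" by (simp add: mult.assoc) (metis cong_sym cong_trans)
      next
        assume "[k = r*i] (mod 13)"
        then have "[k*c = r*i*c] (mod 13)" by (rule cong_scalar_right)
        moreover have "[r*(c*i) = r*1] (mod 13)" using i by (rule cong_scalar_left)
        ultimately show "[k*c = r] (mod 13)" by (simp add: mult_ac) (metis cong_sym cong_trans)
      qed
      also have "\<dots> \<longleftrightarrow> k = (r*i) mod 13" using that by (simp add: cong_def)
      finally show ?thesis .
    qed
    then show ?thesis by (intro bexI[of _ "(r*i) mod 13"]) auto
  qed
  have single: ?thesis
    if "k0 \<in> {0..<13}" "\<forall>k\<in>{0..<13}. annihilates k 1 x \<longleftrightarrow> k = k0" "\<not> annihilates 1 0 x" for k0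
  proof -
    have "(\<Sum>k\<in>{0..<13}. of_bool (annihilates k 1 x)) = (\<Sum>k\<in>{0..<13}. of_bool (k = k0) :: int)"
      using that by (intro sum.cong) auto
    also have "\<dots> = 1" using that(1) by (simp add: of_bool_def sum.delta)
    finally show ?thesis using that(3) by simp
  qed
  consider "13 dvd C" "13 dvd D" | "\<not> 13 dvd C" | "13 dvd C" "\<not> 13 dvd D" by blast
  then show ?thesis
  proof cases
    case 1
    have "annihilates k 1 x \<longleftrightarrow> 13 dvd D' \<and> 13 dvd C'" for k
      using 1 by (simp add: fin dvd_diff_right_iff dvd_add_right_iff)
    then show ?thesis using 1 by (simp add: inf cong_iff_dvd_diff)
  next
    case 2
    obtain k0 where k0: "k0 \<in> {0..<13}" "\<forall>k\<in>{0..<13}. 13 dvd k*C - D' \<longleftrightarrow> k = k0"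
      using solve[OF 2, of D'] by blast
    have "13 dvd k*D + C'" if "13 dvd k*C - D'" for k
    proof -
      have "C*(k*D + C') = (C*C' + D*D') + D*(k*C - D')" by (simp add: algebra_simps)
      then have "13 dvd C*(k*D + C')" using det that by (metis dvd_add dvd_mult)
      then show ?thesis using 2 by (simp add: prime_dvd_mult_iff[OF p13])
    qed
    then show ?thesis using k0 2 by (intro single[of k0]) (auto simp: fin inf)
  next
    case 3
    then have D': "13 dvd D'"
      using det by (simp add: dvd_add_right_iff prime_dvd_mult_iff[OF p13])
    obtain k0 where k0: "k0 \<in> {0..<13}" "\<forall>k\<in>{0..<13}. 13 dvd k*D - (-C') \<longleftrightarrow> k = k0"
      using solve[OF 3(2), of "-C'"] by blast
    then show ?thesis using 3 D' by (intro single[of k0]) (auto simp: fin inf)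
  qed
qed

text \<open>
  Left divisibility by a quaternion of norm 13 means that 13 divides the product with its conjugate. The
  14 rows that the conjugates of \<open>primaries13\<close> have modulo 13 are the 14 points of the projective
  line, each once.
\<close>
lemma count_primaries13:
  assumes "13 dvd qnorm x"
  shows "[(\<Sum>p\<leftarrow>primaries13. of_bool (qdvd 13 (qmul (qconj p) x))) = (1 :: int)] (mod 13)"
proof -
  have fin: "qdvd 13 (qmul (qconj (a, b, c, d)) x) \<longleftrightarrow> annihilates k 1 x"
    if "[a - 5 * b = - (c + 5 * d) * k] (mod 13)" "[c - 5 * d = (a + 5 * b) * k] (mod 13)"
       "\<not> (13 dvd c + 5 * d \<and> 13 dvd a + 5 * b)" for a b c d k
  proof (rule qdvd_qconj_qmul_iff_annihilates)
    show "[a - 5 * b = - (c + 5 * d) * k] (mod 13)" "[c - 5 * d = (a + 5 * b) * k] (mod 13)"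
      by (fact that)+
    show "[c + 5 * d = - (- (c + 5 * d)) * 1] (mod 13)" "[a + 5 * b = (a + 5 * b) * 1] (mod 13)"
      by (simp_all only: mult_1_right minus_minus cong_refl)
    show "\<not> (13 dvd - (c + 5 * d) \<and> 13 dvd a + 5 * b)"
      using that(3) by (simp only: dvd_minus_iff not_False_eq_True)
  qed
  have inf: "qdvd 13 (qmul (qconj (3, 2, 0, 0)) x) \<longleftrightarrow> annihilates 1 0 x"
    by (intro qdvd_qconj_qmul_iff_annihilates[of _ _ "-7" _ _ _ _ 0]) (auto simp: cong_def)
  have "{0..<13} = set [0..12 :: int]" by auto
  also have "[0..12 :: int] = [0,1,2,3,4,5,6,7,8,9,10,11,12]" by (simp add: upto.simps)
  finally have interval: "{0..<13::int} = {0,1,2,3,4,5,6,7,8,9,10,11,12}" by simp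
  have "(\<Sum>p\<leftarrow>primaries13. of_bool (qdvd 13 (qmul (qconj p) x))) =
          (\<Sum>k\<in>{0..<13}. of_bool (annihilates k 1 x)) + (of_bool (annihilates 1 0 x) :: int)"
    unfolding primaries13_def interval
    by (simp add: inf
        fin[of 3 "-2" 0 0 0] fin[of 3 0 0 2 1] fin[of "-1" 2 2 2 2] fin[of "-1" 2 "-2" 2 3]
        fin[of "-1" "-2" "-2" "-2" 4] fin[of 3 0 2 0 5] fin[of "-1" "-2" 2 "-2" 6]
        fin[of "-1" "-2" "-2" 2 7] fin[of 3 0 "-2" 0 8] fin[of "-1" "-2" 2 2 9]
        fin[of "-1" 2 2 "-2" 10] fin[of "-1" 2 "-2" "-2" 11] fin[of 3 0 0 "-2" 12] cong_def
        del: qmul.simps qconj.simps)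
  then show ?thesis using annihilator_count_cong_1[OF assms] by simp
qed

text \<open>
  The number of primary left divisors of norm 13 of a quaternion \<open>x\<close> of norm \<open>13 M\<close> is 1 modulo 13,
  so the sum over \<open>x\<close> may be replaced by the sum over all factorisations \<open>x = p y\<close>. Summing over
  \<open>p\<close> first multiplies the weight by \<open>-418\<close>. This is the action of the Hecke operator at 13, whose
  second term, with coefficient \<open>13^5\<close>, disappears modulo 13.
\<close>
theorem theta_hecke_13: "[theta (13 * M) = -418 * theta M] (mod 13)"
proof -
  let ?D = "\<lambda>p x. qdvd 13 (qmul (qconj p) x)"
  have swap: "(\<Sum>x\<in>A. \<Sum>p\<leftarrow>ps. F p x) = (\<Sum>p\<leftarrow>ps. \<Sum>x\<in>A. F p x)"
    for A ps and F :: "quat \<Rightarrow> quat \<Rightarrow> int"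
    by (induction ps) (simp_all add: sum.distrib)
  have "[theta (13 * M) = (\<Sum>x\<in>quats (13*M). coord_prod x * (\<Sum>p\<leftarrow>primaries13. of_bool (?D p x)))] (mod 13)"
    unfolding theta_def
  proof (rule cong_sum)
    fix x assume "x \<in> quats (13*M)"
    then have "[(\<Sum>p\<leftarrow>primaries13. of_bool (?D p x)) = (1 :: int)] (mod 13)"
      by (intro count_primaries13) (simp add: quats_def)
    then have "[coord_prod x * (\<Sum>p\<leftarrow>primaries13. of_bool (?D p x)) = coord_prod x * 1] (mod 13)"
      by (rule cong_scalar_left)
    then show "[coord_prod x = coord_prod x * (\<Sum>p\<leftarrow>primaries13. of_bool (?D p x))] (mod 13)"
      by (simp add: cong_sym)
  qed
  also have "(\<Sum>x\<in>quats (13*M). coord_prod x * (\<Sum>p\<leftarrow>primaries13. of_bool (?D p x))) =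
          (\<Sum>p\<leftarrow>primaries13. \<Sum>x\<in>quats (13*M). coord_prod x * of_bool (?D p x))"
    by (simp only: swap sum_list_const_mult[symmetric])
  also have "\<dots> = (\<Sum>p\<leftarrow>primaries13. \<Sum>y\<in>quats M. coord_prod (qmul p y))"
  proof (intro arg_cong[of _ _ sum_list] map_cong refl)
    fix p assume "p \<in> set primaries13"
    then have p: "primary p" "qnorm p = 13" using primaries13 by auto
    have "(\<Sum>x\<in>quats (13*M). coord_prod x * of_bool (?D p x)) = (\<Sum>x\<in>{x \<in> quats (13*M). ?D p x}. coord_prod x)"
      by (rule sum.mono_neutral_cong_right) (auto simp: finite_quats)
    then show "(\<Sum>x\<in>quats (13*M). coord_prod x * of_bool (?D p x)) = (\<Sum>y\<in>quats M. coord_prod (qmul p y))"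
      by (simp add: sum_over_left_multiples[OF p])
  qed
  also have "\<dots> = -418 * theta M"
    by (simp only: swap[symmetric] sum_coord_prod_primaries13 theta_def sum_distrib_left)
  finally show ?thesis .
qed

lemma quats_4: "quats 4 = {(1, 1, 1, 1)}"
proof (intro equalityI subsetI)
  fix x assume x: "x \<in> quats 4"
  obtain a b c d where [simp]: "x = (a, b, c, d)" by (cases x)
  have nz: "y^2 \<ge> 1" if "y mod 4 = 1" for y :: int
    using that by (cases "y = 0") (auto simp: one_le_power int_one_le_iff_zero_less)
  have "a^2 = 1" "b^2 = 1" "c^2 = 1" "d^2 = 1"
    using x nz[of a] nz[of b] nz[of c] nz[of d] by (auto simp: quats_def)
  then show "x \<in> {(1, 1, 1, 1)}"
    using x by (auto simp: quats_def power2_eq_1_iff)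
qed (simp add: quats_def)

lemma theta_4_mult_power_13: "\<not> [theta (4 * 13 ^ j) = 0] (mod 13)"
proof -
  have "[theta (4 * 13 ^ j) = (-418) ^ j] (mod 13)"
  proof (induction j)
    case 0
    show ?case by (simp add: theta_def quats_4)
  next
    case (Suc j)
    have "[theta (13 * (4 * 13 ^ j)) = -418 * theta (4 * 13 ^ j)] (mod 13)" by (rule theta_hecke_13)
    also have "[-418 * theta (4 * 13 ^ j) = -418 * (-418) ^ j] (mod 13)"
      using Suc by (rule cong_scalar_left)
    finally show ?case by (simp add: mult_ac)
  qed
  moreover have "\<not> 13 dvd (-418 :: int) ^ j"
    using prime_dvd_power[of "13 :: int" "-418" j] by auto
  ultimately show ?thesis by (metis cong_0_iff cong_dvd_iff)
qed

section \<open>The nonvanishing theorem\<close>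

lemma b_17_5: "b 17 5 = 7"
proof -
  have empty: "card (partitions_with {} n) = (if n = 0 then 1 else 0)" for n
  proof -
    have "partitions_with {} n = (if n = 0 then {{#}} else {})"
      by (auto simp: partitions_with_def)
    then show ?thesis by simp
  qed
  have "partitions_with (regular_parts 17) 5 = partitions_with {5, 4, 3, 2, 1} 5"
  proof -
    have "k \<in> regular_parts 17 \<longleftrightarrow> k \<in> {5, 4, 3, 2, 1}" if "k \<in># p" "sum_mset p = 5" for k p
      using member_le_sum_mset[OF that(1)] that(2)
      by (auto simp: regular_parts_def dest: dvd_imp_le)
    then show ?thesis unfolding partitions_with_def by blast
  qed
  also have "card \<dots> = 7"
    by (simp add: card_partitions_with_insert empty)
  finally show ?thesis by (simp add: b_def)
qed

theorem corollary6p2: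
  shows "(\<forall>r::nat. r > 0 \<longrightarrow>
            (\<exists>m::int. \<not> [b 13 (13 ^ (2 * r) * m + (13 ^ (2 * r) - 1) div 2) = 0] (mod 13))) \<and>
         (\<exists>m::int. \<not> [b 17 (17 * m - 12) = 0] (mod 17))"
proof (intro conjI allI impI)
  fix r :: nat
  \<comment> \<open>With \<open>m = 0\<close> the argument of \<open>b 13\<close> is the \<open>n\<close> for which \<open>8 n + 4\<close> is \<open>4\<close> times a power of 13.\<close>
  define n where "n = ((13::nat) ^ (2 * r) - 1) div 2"
  have "odd ((13::nat) ^ (2 * r))" by simp
  then have n: "(13::nat) ^ (2 * r) = 2 * n + 1" by (simp add: n_def)
  then have n': "(13::int) ^ (2 * r) = 2 * int n + 1"
    by (metis of_nat_1 of_nat_add of_nat_mult of_nat_numeral of_nat_power)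
  have "8 * int n + 4 = 4 * 13 ^ (2 * r)" by (simp add: n')
  then have "\<not> [int (b 13 (int n)) = 0] (mod 13)"
    using theta_4_mult_power_13[of "2 * r"] b_13_cong_theta[of n] by (metis cong_sym cong_trans)
  then have "\<not> [b 13 (int n) = 0] (mod 13)"
    using cong_int_iff[of "b 13 (int n)" 0 13] by simp
  then show "\<exists>m::int. \<not> [b 13 (13 ^ (2 * r) * m + (13 ^ (2 * r) - 1) div 2) = 0] (mod 13)"
    by (intro exI[of _ 0]) (simp add: n')
next
  have "b 17 (17 * 1 - 12) = 7" by (simp add: b_17_5)
  then show "\<exists>m::int. \<not> [b 17 (17 * m - 12) = 0] (mod 17)"
    by (intro exI[of _ 1]) (simp add: cong_def)
qed

end
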